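(* For each $k\ge 1$, let $$R_{k-1}(q)=\begin{cases}P_{k-1}(q), & \text{if } k\not\equiv 2 \pmod 3,\\ P_{k-1}(q)/(q^2+q+1), & \text{if } k\equiv 2\pmod 3.\end{cases}$$ Then $R_{k-1}(q)$ is a polynomial in $\mathbb{Z}[q]$ that is irreducible over $\mathbb{Q}$.
   Context: For $k\ge 1$, define $P_{k-1}(q)=1+\sum_{l=1}^{k} q^{4l-4}(q^4-q^3-q^2-q)=q^{4k}-q^{4k-1}-q^{4k-2}-q^{4k-3}+q^{4k-4}-\cdots-q^5+q^4-q^3-q^2-q+1$. Equivalently $P_0=q^4-q^3-q^2-q+1$, $P_1=q^8-q^7-q^6-q^5+q^4-q^3-q^2-q+1$, and $P_k=(q^4+1)P_{k-1}-q^4P_{k-2}$. One has $P_k(q)=q^{2k+2}\,q_k(q+q^{-1}+2)$, where $q_0(x)=x^2-5x+3$, $q_1(x)=(x^3-8x^2+17x-5)(x-1)$, $q_k=(x^2-4x+2)q_{k-1}-q_{k-2}$. *)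

theory Defs
  imports "HOL-Computational_Algebra.Polynomial"
begin

text \<open>P_{k-1}(q) = 1 + sum_{l=1}^{k} q^(4l-4) (q^4 - q^3 - q^2 - q), as an integer polynomial.
  We index by k (k \<ge> 1), so P_poly k denotes P_{k-1}.\<close>
definition P_poly :: "nat \<Rightarrow> int poly" where
  "P_poly k = 1 + (\<Sum>l=1..k. monom 1 (4*l - 4) * [:0, -1, -1, -1, 1:])"

definition R_poly :: "nat \<Rightarrow> int poly" where
  "R_poly k = (if k mod 3 = 2 then P_poly k div [:1, 1, 1:] else P_poly k)"

end

theory Submission
  imports Defs "HOL-Complex_Analysis.Complex_Analysis"
    "HOL-Computational_Algebra.Fundamental_Theorem_Algebra"
begin

text \<open>
  Put \<open>m = 4k + 1\<close> and \<open>T = x\<^sup>3 - x\<^sup>2 - x - 1\<close>, with reciprocal \<open>T* = 1 - x - x\<^sup>2 - x\<^sup>3\<close>. Then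
  \<open>(x\<^sup>4 - 1) P = x\<^sup>m T - T*\<close> and \<open>P \<equiv> 1 (mod T)\<close>.

  Since \<open>T\<close> has one root \<open>b\<close> outside the unit disc and two inside, the roots of \<open>P\<close> in the open
  unit disc are fixed points of a self-map of the disc that is not the identity. By the Schwarz lemma
  there is at most one, and it is simple. So if \<open>R = A B\<close> over the integers with non-constant
  factors, one of them, say \<open>A\<close>, has no root in the open disc; as \<open>A(0) = \<plusminus>1\<close>, all roots of \<open>A\<close>
  lie on the unit circle.

  For \<open>|z| = 1\<close> one has \<open>|T(z)|\<^sup>2 = |1 - z\<^sup>3|\<^sup>2 + |1 + z|\<^sup>2\<close>. Taking products over the roots of \<open>A\<close>
  gives \<open>|A(1) A(w) A(w\<^sup>2)| < |Res(A, T)|\<close>, where \<open>w\<close> is a primitive cube root of unity. The right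
  side is 1 because \<open>Res(P, T) = \<plusminus>1\<close>, and the left side is an integer, so \<open>A\<close> vanishes at \<open>1\<close>,
  \<open>w\<close> or \<open>w\<^sup>2\<close>; but \<open>R\<close> does not.
\<close>

section \<open>Fixed points of self-maps of the unit disc\<close>

text \<open>Conjugating by the Moebius map that takes \<open>a\<close> to 0 gives the equality case
  of the Schwarz lemma: a second fixed point yields \<open>norm (g w) = norm w\<close> with
  \<open>w \<noteq> 0\<close>, and derivative 1 yields \<open>norm (deriv g 0) = 1\<close>. Either
  way \<open>g\<close> is multiplication by a constant, which must be 1.\<close>

lemma disc_self_map_identity:
  fixes f :: "complex \<Rightarrow> complex"
  assumes hol: "f holomorphic_on ball 0 1"
    and maps: "\<And>z. norm z < 1 \<Longrightarrow> norm (f z) < 1"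
    and a: "norm a < 1" "f a = a"
    and two: "(\<exists>b. norm b < 1 \<and> b \<noteq> a \<and> f b = b) \<or> (f has_field_derivative 1) (at a)"
    and z: "norm z < 1"
  shows "f z = z"
proof -
  define M where "M = Moebius_function 0 a"
  define M' where "M' = Moebius_function 0 (-a)"
  define g where "g = (\<lambda>z. M (f (M' z)))"
  have M0: "M a = 0" "M' 0 = a"
    by (auto simp: M_def M'_def Moebius_function_def)
  have MM': "M (M' w) = w" "M' (M w) = w" if "norm w < 1" for w
    using that a unfolding M_def M'_def by (auto intro!: Moebius_function_compose)
  have Mn: "norm (M w) < 1" "norm (M' w) < 1" if "norm w < 1" for w
    using that a unfolding M_def M'_def by (auto intro!: Moebius_function_norm_lt_1)
  have Mh: "M holomorphic_on ball 0 1" "M' holomorphic_on ball 0 1"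
    using a unfolding M_def M'_def by (auto intro!: Moebius_function_holomorphic)
  have "(M \<circ> (f \<circ> M')) holomorphic_on ball 0 1"
    using Mh hol Mn maps by (intro holomorphic_on_compose_gen[where t = "ball 0 1"]) auto
  then have gh: "g holomorphic_on ball 0 1"
    by (simp add: g_def o_def)
  have g0: "g 0 = 0" using M0 a by (simp add: g_def)
  have gn: "norm (g w) < 1" if "norm w < 1" for w
    using that Mn maps by (simp add: g_def)
  have id: "\<forall>w. norm w < 1 \<longrightarrow> g w = w"
    using two
  proof
    assume "\<exists>b. norm b < 1 \<and> b \<noteq> a \<and> f b = b"
    then obtain b where b: "norm b < 1" "b \<noteq> a" "f b = b" by blast
    define w where "w = M b"
    have w: "norm w < 1" "w \<noteq> 0" "g w = w"
      using b Mn MM' M0 by (auto simp: w_def g_def) (metis M0(2) MM'(2))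
    then obtain c where c: "\<forall>z. norm z < 1 \<longrightarrow> g z = c * z"
      using Schwarz_Lemma(3)[OF gh g0 gn w(1)] by metis
    with w have "c = 1" by auto
    with c show ?thesis by simp
  next
    assume f': "(f has_field_derivative 1) (at a)"
    obtain u where u: "(M has_field_derivative u) (at a)"
      using Mh(1) a(1) by (metis holomorphic_derivI open_ball mem_ball_0)
    obtain v where v: "(M' has_field_derivative v) (at 0)"
      using Mh(2) by (metis holomorphic_derivI open_ball mem_ball_0 norm_zero zero_less_one)
    \<comment> \<open>Differentiating \<open>M (M' w) = w\<close> gives \<open>u * v = 1\<close>, so
      conjugation preserves the derivative at the fixed point.\<close>
    have "((\<lambda>w. M (M' w)) has_field_derivative u * v) (at 0)"
      by (rule DERIV_chain2) (use u v M0 in auto)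
    then have "((\<lambda>w. w) has_field_derivative u * v) (at 0)"
      by (rule has_field_derivative_transform_within_open[where S = "ball 0 1"]) (auto simp: MM')
    then have uv: "u * v = 1"
      by (metis DERIV_ident DERIV_unique)
    have "((\<lambda>w. f (M' w)) has_field_derivative 1 * v) (at 0)"
      by (rule DERIV_chain2) (use f' v M0 in auto)
    then have "(g has_field_derivative u * (1 * v)) (at 0)"
      unfolding g_def by (intro DERIV_chain2[of M]) (use u M0 a in auto)
    then have g': "(g has_field_derivative 1) (at 0)"
      by (simp add: uv)
    then obtain c where c: "\<forall>z. norm z < 1 \<longrightarrow> g z = c * z"
      using Schwarz_Lemma(3)[OF gh g0 gn, of 0] by (auto simp: DERIV_imp_deriv)
    have "((\<lambda>w. c * w) has_field_derivative 1) (at 0)"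
      by (rule has_field_derivative_transform_within_open[OF g', where S = "ball 0 1"]) (auto simp: c)
    moreover have "((\<lambda>w. c * w) has_field_derivative c) (at 0)"
      by (auto intro!: derivative_eq_intros)
    ultimately have "c = 1" by (metis DERIV_unique)
    with c show ?thesis by simp
  qed
  have "M' (g (M z)) = M' (M z)"
    using id Mn z by simp
  then show ?thesis
    using z MM' Mn maps by (simp add: g_def)
qed

section \<open>The tribonacci constant and two Blaschke estimates\<close>

lemma tribonacci_constant_exists:
  obtains b :: real where "1 < b" "b < 2" "b^3 = b^2 + b + 1"
proof -
  have "\<exists>x\<ge>1. x \<le> 2 \<and> x^3 - x^2 - x - 1 = (0::real)"
    by (rule IVT') (auto intro!: continuous_intros)
  then obtain b :: real where b: "1 \<le> b" "b \<le> 2" "b^3 - b^2 - b - 1 = 0" by blast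
  then have "b \<noteq> 1" "b \<noteq> 2" by auto
  with b show ?thesis by (intro that[of b]) auto
qed

text \<open>The conditions on \<open>s\<close> and \<open>p\<close> put both roots of
  \<open>z^2 + s*z + p\<close> in the open disc, so the quotient of the two sides is a Blaschke
  product. Concretely, the squared norms differ by
  \<open>(1 - p) * (1 - r) * ((1 + p) * (1 + r) + 2*s*x)\<close> with \<open>r\<close> the squared
  norm of \<open>z\<close>; the last factor is positive because
  \<open>- 2*x \<le> 1 + r\<close>.\<close>

lemma quadratic_blaschke_bound:
  fixes s p :: real and z :: complex
  assumes "0 \<le> s" "s < 1 + p" "p < 1" "norm z < 1"
  shows "norm (z^2 + s * z + p) < norm (1 + s * z + p * z^2)"
proof -
  obtain x y where z: "z = Complex x y" by (cases z)
  define r where "r = x^2 + y^2"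
  have r: "r < 1" "0 \<le> r" using assms(4) by (auto simp: r_def z complex_norm)
  have "0 \<le> (x + 1)^2 + y^2" by simp
  then have "- (2 * x) \<le> 1 + r" by (simp add: r_def power2_eq_square algebra_simps)
  then have "s * (- (2 * x)) \<le> s * (1 + r)" using assms(1) by (intro mult_left_mono)
  also have "\<dots> < (1 + p) * (1 + r)" using assms r by (intro mult_strict_right_mono) auto
  finally have "0 < (1 - p) * (1 - r) * ((1 + p) * (1 + r) + 2 * s * x)"
    using assms r by (intro mult_pos_pos) auto
  also have "\<dots> = (norm (1 + s * z + p * z^2))^2 - (norm (z^2 + s * z + p))^2"
    unfolding cmod_power2 z r_def by (simp add: power2_eq_square) algebra
  finally show ?thesis
    by (simp add: power2_less_imp_less)
qed

text \<open>The squared norms differ by \<open>b^2 - 1\<close> times one minus the squared norm of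
  \<open>u\<close>. This keeps the self-map built below inside the disc.\<close>

lemma disc_automorphism_bound:
  fixes b :: real and u :: complex
  assumes "1 < b" "norm u < 1"
  shows "norm (1 + b * u) < norm (b + u)"
proof -
  obtain x y where u: "u = Complex x y" by (cases u)
  have "x^2 + y^2 < 1" using assms(2) by (auto simp: u complex_norm)
  moreover have "1 < b^2" using assms(1) by (simp add: one_less_power)
  ultimately have "0 < (b^2 - 1) * (1 - (x^2 + y^2))" by simp
  also have "\<dots> = (norm (b + u))^2 - (norm (1 + b * u))^2"
    unfolding cmod_power2 u by (simp add: power2_eq_square) algebra
  finally show ?thesis
    by (simp add: power2_less_imp_less)
qed

section \<open>Gauss's lemma: from integer to rational irreducibility\<close>

lemma map_poly_of_int_mult:
  "map_poly of_int (p * q) = (map_poly of_int p * map_poly of_int q :: 'a :: {comm_ring_1, ring_char_0} poly)"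
  by (intro poly_eqI) (simp add: coeff_map_poly coeff_mult)

lemma map_poly_of_int_add:
  "map_poly of_int (p + q) = (map_poly of_int p + map_poly of_int q :: 'a :: {comm_ring_1, ring_char_0} poly)"
  by (intro poly_eqI) (simp add: coeff_map_poly)

lemma map_poly_of_int_smult:
  "map_poly of_int (smult c p) = smult (of_int c :: 'a :: {comm_ring_1, ring_char_0}) (map_poly of_int p)"
  by (intro poly_eqI) (simp add: coeff_map_poly)

lemma degree_map_poly_of_int:
  "degree (map_poly of_int p :: 'a :: {comm_ring_1, ring_char_0} poly) = degree p"
  by (rule degree_map_poly) simp

lemma map_poly_of_int_eq_iff:
  "map_poly of_int p = (map_poly of_int q :: 'a :: {comm_ring_1, ring_char_0} poly) \<longleftrightarrow> p = q"
  by (simp add: poly_eq_iff coeff_map_poly)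

text \<open>\<open>d\<close> clears the denominators, one coefficient at a time; \<open>e\<close> is
  the content of the resulting integer polynomial.\<close>

lemma rat_poly_primitive_int_multiple:
  fixes p :: "rat poly"
  assumes "p \<noteq> 0"
  obtains d e :: int and q where "d \<noteq> 0" "e \<noteq> 0" "Polynomial.content q = 1"
    "smult (of_int d) p = smult (of_int e) (map_poly of_int q)"
proof -
  have "\<exists>d::int. d \<noteq> 0 \<and> (\<forall>i. of_int d * coeff p i \<in> \<int>)"
  proof (induction p)
    case 0
    show ?case by (intro exI[of _ 1]) auto
  next
    case (pCons a p)
    then obtain d :: int where d: "d \<noteq> 0" "\<forall>i. of_int d * coeff p i \<in> \<int>" by blast
    obtain u v where uv: "quotient_of a = (u, v)" by fastforce
    have v: "v > 0" "a = of_int u / of_int v"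
      using uv quotient_of_denom_pos quotient_of_div by auto
    have "of_int (d * v) * coeff (pCons a p) i \<in> \<int>" for i
    proof (cases i)
      case 0
      have "of_int (d * v) * coeff (pCons a p) i = (of_int (d * u) :: rat)"
        using v 0 by simp
      then show ?thesis by (metis Ints_of_int)
    next
      case (Suc j)
      have "of_int v * (of_int d * coeff p j) \<in> \<int>"
        by (rule Ints_mult[OF Ints_of_int]) (use d(2) in blast)
      with Suc show ?thesis by (simp add: mult_ac)
    qed
    with d v show ?case by (intro exI[of _ "d * v"]) auto
  qed
  then obtain d :: int where d: "d \<noteq> 0" "\<forall>i. of_int d * coeff p i \<in> \<int>" by blast
  then obtain q where q: "smult (of_int d) p = map_poly of_int q"
    by (elim intpolyE[of "smult (of_int d) p", rotated]) auto
  obtain q' where q': "q = smult (Polynomial.content q) q'" "Polynomial.content q' = 1"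
    by (rule content_decompose)
  have "Polynomial.content q \<noteq> 0"
    using q assms d(1) by auto
  moreover have "smult (of_int d) p = smult (of_int (Polynomial.content q)) (map_poly of_int q')"
    by (metis q q'(1) map_poly_of_int_smult)
  ultimately show ?thesis using that d(1) q'(2) by blast
qed

text \<open>A non-constant irreducible \<open>p\<close> is primitive. A rational factorization
  becomes \<open>d d' p = e e' q r\<close> with primitive \<open>q\<close>, \<open>r\<close>;
  comparing contents leaves only a sign, so \<open>p\<close> equals \<open>q r\<close> up to sign
  already over the integers.\<close>

lemma irreducible_map_poly_rat_of_int:
  fixes p :: "int poly"
  assumes "irreducible p" "degree p > 0"
  shows "irreducible (map_poly (of_int :: int \<Rightarrow> rat) p)"
proof (rule irreducibleI)
  let ?h = "map_poly (of_int :: int \<Rightarrow> rat)"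
  have p0: "?h p \<noteq> 0" using degree_map_poly_of_int[of p, where 'a = rat] assms(2) by auto
  show "?h p \<noteq> 0" by fact
  show "\<not> ?h p dvd 1"
    using assms(2) p0 by (simp add: is_unit_iff_degree degree_map_poly_of_int)
  have cp: "Polynomial.content p = 1"
  proof -
    have "p = [:Polynomial.content p:] * primitive_part p" by simp
    then have "[:Polynomial.content p:] dvd 1 \<or> primitive_part p dvd 1"
      using assms(1) irreducibleD by blast
    moreover have "\<not> primitive_part p dvd 1"
      using assms(2) by (auto simp: is_unit_poly_iff dest!: arg_cong[of _ _ degree])
    ultimately show ?thesis
      by (metis content_dvd is_unit_const_poly_iff is_unit_content_iff normalize_content normalize_1_iff is_unit_normalize)
  qed
  fix a b assume ab: "?h p = a * b"
  have ab0: "a \<noteq> 0" "b \<noteq> 0" using ab p0 by auto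
  obtain d e q where q: "d \<noteq> 0" "e \<noteq> 0" "Polynomial.content q = 1" "smult (of_int d) a = smult (of_int e) (?h q)"
    using rat_poly_primitive_int_multiple[OF ab0(1)] by metis
  obtain d' e' r where r: "d' \<noteq> 0" "e' \<noteq> 0" "Polynomial.content r = 1" "smult (of_int d') b = smult (of_int e') (?h r)"
    using rat_poly_primitive_int_multiple[OF ab0(2)] by metis
  have "?h (smult (d * d') p) = smult (of_int d) a * smult (of_int d') b"
    by (simp add: map_poly_of_int_smult ab mult.commute)
  also have "\<dots> = ?h (smult (e * e') (q * r))"
    unfolding q(4) r(4) by (simp add: map_poly_of_int_smult map_poly_of_int_mult mult.commute)
  finally have eq: "smult (d * d') p = smult (e * e') (q * r)"
    by (simp only: map_poly_of_int_eq_iff)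
  have "Polynomial.content (smult (d * d') p) = Polynomial.content (smult (e * e') (q * r))"
    by (simp only: eq)
  then have "\<bar>d * d'\<bar> = \<bar>e * e'\<bar>"
    by (simp add: content_mult cp q r)
  then have sgn: "d * d' = e * e' \<or> d * d' = - (e * e')" by (simp only: abs_eq_iff)
  have dd: "d * d' \<noteq> 0" using q r by simp
  have "p = q * r \<or> p = (- q) * r"
    using sgn
  proof
    assume 1: "d * d' = e * e'"
    have "smult (d * d') p = smult (d * d') (q * r)"
      unfolding eq by (simp only: 1)
    from smult_cancel[OF dd this] show ?thesis by blast
  next
    assume 2: "d * d' = - (e * e')"
    have "smult (d * d') p = smult (d * d') ((- q) * r)"
      unfolding eq by (simp only: 2 smult_minus_left smult_minus_right mult_minus_left minus_minus)
    from smult_cancel[OF dd this] show ?thesis by blast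
  qed
  then have "q dvd 1 \<or> r dvd 1"
    using irreducibleD[OF assms(1), of q r] irreducibleD[OF assms(1), of "- q" r] by auto
  then have "degree q = 0 \<or> degree r = 0"
    by (auto simp: is_unit_poly_iff)
  moreover have "degree a = degree q" "degree b = degree r"
    using arg_cong[OF q(4), of degree] arg_cong[OF r(4), of degree] q(1,2) r(1,2)
    by (simp_all add: degree_map_poly_of_int)
  ultimately show "a dvd 1 \<or> b dvd 1"
    using ab0 by (simp add: is_unit_iff_degree)
qed

section \<open>Special values and closed form of \<open>P\<close>\<close>

abbreviation ipoly :: "int poly \<Rightarrow> complex \<Rightarrow> complex" where
  "ipoly p \<equiv> poly (map_poly of_int p)"

lemma ipoly_mult: "ipoly (p * q) z = ipoly p z * ipoly q z"
  by (simp add: map_poly_of_int_mult)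

lemma ipoly_add: "ipoly (p + q) z = ipoly p z + ipoly q z"
  by (simp add: map_poly_of_int_add)

lemma ipoly_of_int: "ipoly p (of_int n) = of_int (poly p n)"
  by (induction p) (auto simp: map_poly_pCons)

lemma P_poly_Suc: "P_poly (Suc k) = P_poly k + monom 1 (4 * k) * [:0, -1, -1, -1, 1:]"
  by (simp add: P_poly_def)

lemma P_poly_degree: "degree (P_poly k) = 4 * k" and P_poly_lead_coeff: "lead_coeff (P_poly k) = 1"
proof -
  have "degree (P_poly k) = 4 * k \<and> lead_coeff (P_poly k) = 1"
  proof (induction k)
    case 0
    show ?case by (simp add: P_poly_def)
  next
    case (Suc k)
    define f :: "int poly" where "f = [:0, -1, -1, -1, 1:]"
    define q where "q = monom 1 (4 * k) * f"
    have "degree f = 4" "lead_coeff f = 1" "f \<noteq> 0" by (simp_all add: f_def)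
    then have "degree q = 4 * k + 4" "lead_coeff q = 1"
      unfolding q_def by (simp_all only: lead_coeff_mult) (simp_all add: degree_mult_eq degree_monom_eq)
    with Suc show ?case
      unfolding P_poly_Suc f_def[symmetric] q_def[symmetric] by (simp add: degree_add_eq_right coeff_eq_0)
  qed
  then show "degree (P_poly k) = 4 * k" "lead_coeff (P_poly k) = 1" by auto
qed

lemma poly_P_poly_Suc:
  "poly (P_poly (Suc k)) n = poly (P_poly k) n + n ^ (4 * k) * (n^4 - n^3 - n^2 - n)"
  by (simp add: P_poly_Suc poly_monom algebra_simps eval_nat_numeral)

lemma P_poly_0: "poly (P_poly k) 0 = 1"
  by (induction k) (simp_all add: poly_P_poly_Suc, simp add: P_poly_def)

lemma P_poly_1: "poly (P_poly k) 1 = 1 - 2 * int k"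
  by (induction k) (simp_all add: poly_P_poly_Suc, simp add: P_poly_def)

lemma P_poly_minus_1: "poly (P_poly k) (-1) = 1 + 2 * int k"
  by (induction k) (simp_all add: poly_P_poly_Suc, simp add: P_poly_def)

lemma ipoly_P_Suc:
  "ipoly (P_poly (Suc k)) z = ipoly (P_poly k) z + z ^ (4 * k) * (z^4 - z^3 - z^2 - z)"
proof -
  have "ipoly (monom 1 n) z = z ^ n" for n
    by (simp add: map_poly_monom poly_monom)
  moreover have "ipoly [:0, -1, -1, -1, 1:] z = z^4 - z^3 - z^2 - z"
    by (simp add: map_poly_pCons algebra_simps eval_nat_numeral)
  ultimately show ?thesis
    by (simp only: P_poly_Suc ipoly_add ipoly_mult)
qed

lemma ipoly_P_0: "ipoly (P_poly 0) z = 1"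
  by (simp add: P_poly_def map_poly_pCons one_pCons)

text \<open>The factor \<open>z^4 - 1\<close> telescopes the geometric sum in
  \<open>z^4\<close>.\<close>

lemma ipoly_P_closed_form:
  "(z^4 - 1) * ipoly (P_poly k) z = z^(4*k+1) * (z^3 - z^2 - z - 1) - (1 - z - z^2 - z^3)"
proof (induction k)
  case 0
  show ?case unfolding ipoly_P_0 by (simp add: eval_nat_numeral algebra_simps)
next
  case (Suc k)
  define y where "y = z ^ (4 * k)"
  have e: "z ^ (4 * k + 1) = z * y" "z ^ (4 * Suc k + 1) = z^5 * y"
    by (simp_all add: y_def power_add eval_nat_numeral)
  have "(z^4 - 1) * ipoly (P_poly (Suc k)) z = (z^4 - 1) * ipoly (P_poly k) z + (z^4-1) * y * (z^4 - z^3 - z^2 - z)"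
    unfolding ipoly_P_Suc y_def by (simp add: algebra_simps)
  then show ?case unfolding Suc.IH e by algebra
qed

text \<open>Every increment of \<open>P_poly\<close> contains the factor \<open>T\<close>. Hence
  complementary factors of \<open>P\<close> take inverse values at the roots of \<open>T\<close>,
  which later makes the resultant of a factor with \<open>T\<close> a unit.\<close>

lemma ipoly_P_tribonacci_root:
  assumes "z^3 - z^2 - z - 1 = 0"
  shows "ipoly (P_poly k) z = 1"
proof (induction k)
  case (Suc k)
  have "z^4 - z^3 - z^2 - z = z * (z^3 - z^2 - z - 1)" by algebra
  then show ?case using Suc assms by (simp add: ipoly_P_Suc)
qed (rule ipoly_P_0)

section \<open>At most one root in the open disc\<close>

text \<open>The two roots are fixed points of a self-map \<open>f\<close> of the disc. If they
  coincide, they form a double zero of \<open>f z - z\<close>, so \<open>f\<close> has derivative 1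
  there. Both cases force \<open>f\<close> to be the identity.\<close>

lemma P_poly_factors_disc_roots:
  assumes P: "P_poly k = A * B"
    and z: "norm z < 1" "ipoly A z = 0" and w: "norm w < 1" "ipoly B w = 0"
  shows False
proof -
  obtain b :: real where b: "1 < b" "b < 2" "b^3 = b^2 + b + 1"
    by (rule tribonacci_constant_exists)
  \<comment> \<open>By Vieta, these are the coefficients of the cofactor of \<open>x - b\<close> in
    \<open>T\<close>.\<close>
  define s p where "s = b - 1" and "p = 1 / b"
  have "0 < p" "p < 1" using b by (simp_all add: p_def)
  then have sp: "0 \<le> s" "s < 1 + p" "p < 1" using b by (auto simp: s_def)
  have pb: "p * b = 1" using b by (simp add: p_def)
  define N D where "N = (\<lambda>z::complex. z^2 + s * z + p)" and "D = (\<lambda>z::complex. 1 + s * z + p * z^2)"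
  have ND: "norm (N x) < norm (D x)" if "norm x < 1" for x
    using quadratic_blaschke_bound[OF sp that] by (simp add: N_def D_def)
  then have D0: "D x \<noteq> 0" if "norm x < 1" for x
    using that by fastforce
  \<comment> \<open>This is \<open>z^m T / T*\<close> with the factors belonging to the outer root
    \<open>b\<close> removed, so that it is a Blaschke product.\<close>
  define u where "u = (\<lambda>z. z^(4*k+1) * (N z / D z))"
  have u: "norm (u x) < 1" if "norm x < 1" for x
  proof -
    have "norm (x^(4*k+1)) \<le> 1"
      using that by (simp add: norm_power power_le_one del: power_Suc)
    moreover have "norm (N x / D x) < 1"
      using ND[OF that] D0[OF that] by (simp add: norm_divide)
    ultimately show ?thesis
      unfolding u_def norm_mult by (meson mult_left_le_one_le norm_ge_zero order_le_less_trans)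
  qed
  have ub: "norm (1 + b * u x) < norm (b + u x)" if "norm x < 1" for x
    using disc_automorphism_bound[OF b(1) u[OF that]] .
  then have ub0: "b + u x \<noteq> 0" if "norm x < 1" for x
    using that by fastforce
  \<comment> \<open>\<open>f z = z\<close> says \<open>u z = (1 - b z) / (z - b)\<close>, which is \<open>z\<^sup>m T(z) = T*(z)\<close>.\<close>
  define f where "f = (\<lambda>z. (1 + b * u z) / (b + u z))"
  have f_maps: "norm (f x) < 1" if "norm x < 1" for x
    using ub[OF that] ub0[OF that] by (simp add: f_def norm_divide)
  have u_hol: "u holomorphic_on ball 0 1"
    unfolding u_def using D0 unfolding N_def D_def by (intro holomorphic_intros) auto
  have f_hol: "f holomorphic_on ball 0 1"
    unfolding f_def using ub0 by (intro holomorphic_intros u_hol) auto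
  have factors: "x^3 - x^2 - x - 1 = (x - b) * N x" "1 - x - x^2 - x^3 = (1 - b * x) * D x" for x :: complex
  proof -
    \<comment> \<open>Rewriting \<open>1 / b\<close> as \<open>b^2 - b - 1\<close> makes both
      factorizations polynomial identities modulo the cubic relation for \<open>b\<close>.\<close>
    have "p * b^3 = p * (b^2 + b + 1)" by (simp add: b(3))
    then have p: "p = b^2 - b - 1" using pb by (simp add: eval_nat_numeral algebra_simps)
    define B where "B = complex_of_real b"
    have 1: "B^3 = B^2 + B + 1"
      using arg_cong[OF b(3), of complex_of_real] by (simp add: B_def)
    have 2: "complex_of_real p = B^2 - B - 1"
      by (simp add: B_def p)
    show "x^3 - x^2 - x - 1 = (x - b) * N x" "1 - x - x^2 - x^3 = (1 - b * x) * D x"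
      using 1 unfolding N_def D_def s_def 2 by (simp_all flip: B_def) algebra+
  qed
  \<comment> \<open>The cofactor in \<open>f z - z = A(z) B(z) h(z)\<close>: it is holomorphic on
    the disc, so zeros of \<open>A B\<close> pass to \<open>f z - z\<close> with at least their
    multiplicity.\<close>
  define h where "h = (\<lambda>z. (1 - z^4) / (D z * (b + u z)))"
  have fh: "f x = x + ipoly A x * (ipoly B x * h x)" if x: "norm x < 1" for x
  proof -
    have "(x^4 - 1) * (ipoly A x * ipoly B x) = x^(4*k+1) * ((x - b) * N x) - (1 - b * x) * D x"
      using ipoly_P_closed_form[of x k] by (simp only: P ipoly_mult factors)
    also have "x^(4*k+1) * ((x - b) * N x) = u x * (x - b) * D x"
      using D0[OF x] by (simp add: u_def)
    finally have "ipoly A x * ipoly B x * (1 - x^4) = (1 - b * x - u x * (x - b)) * D x"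
      by algebra
    then have "ipoly A x * (ipoly B x * h x) = (1 - b * x - u x * (x - b)) / (b + u x)"
      using D0[OF x] ub0[OF x] by (simp add: h_def mult.assoc[symmetric])
    also have "\<dots> = f x - x"
      using ub0[OF x] by (simp add: f_def field_simps)
    finally show ?thesis by simp
  qed
  have fz: "f z = z" "f w = w" using fh z w by auto
  have "(\<exists>b. norm b < 1 \<and> b \<noteq> z \<and> f b = b) \<or> (f has_field_derivative 1) (at z)"
  proof (cases "w = z")
    case True
    have "h holomorphic_on ball 0 1"
      unfolding h_def using D0 ub0 by (intro holomorphic_intros u_hol) (auto simp: D_def intro!: holomorphic_intros)
    then obtain h' where h': "(h has_field_derivative h') (at z)"
      using z(1) by (metis holomorphic_derivI open_ball mem_ball_0)
    have "((\<lambda>x. x + ipoly A x * (ipoly B x * h x)) has_field_derivative 1) (at z)"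
      by (rule derivative_eq_intros poly_DERIV h' refl)+ (use z w True in simp)
    then have "(f has_field_derivative 1) (at z)"
      by (rule has_field_derivative_transform_within_open[where S = "ball 0 1"]) (use z fh in auto)
    then show ?thesis ..
  qed (use w fz in blast)
  \<comment> \<open>The contradiction is at 0: there \<open>u\<close> vanishes, so
    \<open>f 0 = 1 / b\<close>.\<close>
  then have "f 0 = 0"
    using disc_self_map_identity[OF f_hol f_maps z(1) fz(1), of 0] by simp
  then show False
    using b by (simp add: f_def u_def)
qed

section \<open>The unit circle identity and integrality of norms\<close>

text \<open>Pythagoras: \<open>T = (z^3 - 1) - z * (1 + z)\<close>, and on the circle division by a
  square root of \<open>z^3\<close> makes the first term imaginary and the second real.\<close>

lemma tribonacci_unit_circle_identity:
  fixes z :: complex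
  assumes "norm z = 1"
  shows "(norm (z^3 - z^2 - z - 1))^2 = (norm (1 - z^3))^2 + (norm (1 + z))^2"
proof -
  obtain x y where z: "z = Complex x y" by (cases z)
  have "x^2 + y^2 = 1" using assms by (simp add: z complex_norm real_sqrt_eq_1_iff)
  then show ?thesis
    unfolding cmod_power2 z by (simp add: power2_eq_square power3_eq_cube) algebra
qed

lemma tribonacci_factorization:
  obtains t1 t2 t3 :: complex where
    "\<And>z. z^3 - z^2 - z - 1 = (z - t1) * (z - t2) * (z - t3)"
    "t1 + t2 + t3 = 1" "t1 * t2 + t1 * t3 + t2 * t3 = -1" "t1 * t2 * t3 = 1"
proof -
  define T :: "complex poly" where "T = [:-1, -1, -1, 1:]"
  have T: "T \<noteq> 0" "degree T = 3" "lead_coeff T = 1" by (simp_all add: T_def)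
  obtain M where M: "size M = 3" "T = (\<Prod>x\<in>#M. [:-x, 1:])"
    using alg_closed_imp_factorization[OF T(1)] T by auto
  obtain t1 t2 t3 where "M = {#t1, t2, t3#}"
    using M(1) by (metis Suc_inject numeral_3_eq_3 size_add_mset size_eq_0_iff_empty size_eq_Suc_imp_eq_union)
  then have T_eq: "T = [:-t1, 1:] * ([:-t2, 1:] * [:-t3, 1:])"
    using M(2) by simp
  show ?thesis
  proof
    show "z^3 - z^2 - z - 1 = (z - t1) * (z - t2) * (z - t3)" for z
      using arg_cong[OF T_eq, of "\<lambda>p. poly p z"]
      by (simp add: T_def algebra_simps eval_nat_numeral)
    have c: "coeff T i = coeff ([:-t1, 1:] * ([:-t2, 1:] * [:-t3, 1:])) i" for i
      by (simp only: T_eq)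
    show "t1 * t2 * t3 = 1" using c[of 0] by (simp add: T_def mult_ac)
    have "-1 = t1 * t2 + t1 * t3 + t2 * t3" using c[of 1] by (simp add: T_def algebra_simps)
    then show "t1 * t2 + t1 * t3 + t2 * t3 = -1" ..
    show "t1 + t2 + t3 = 1" using c[of 2] by (simp add: T_def eval_nat_numeral) algebra
  qed
qed

lemma ipoly_tribonacci_reduce:
  "\<exists>a b c :: int. \<forall>z. z^3 - z^2 - z - 1 = 0 \<longrightarrow> ipoly A z = of_int a + of_int b * z + of_int c * z^2"
proof (induction A)
  case (pCons n A)
  then obtain a b c :: int
    where abc: "\<And>z. z^3 - z^2 - z - 1 = 0 \<Longrightarrow> ipoly A z = of_int a + of_int b * z + of_int c * z^2"
    by blast
  have "ipoly (pCons n A) z = of_int (n + c) + of_int (a + c) * z + of_int (b + c) * z^2"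
    if "z^3 - z^2 - z - 1 = 0" for z
    using that by (simp add: map_poly_pCons abc[OF that]) algebra
  then show ?case by blast
qed (auto intro!: exI[of _ 0])

text \<open>The product is the resultant of \<open>T\<close> and \<open>A\<close>. After reduction
  of \<open>A\<close> modulo \<open>T\<close> it is a symmetric polynomial in the roots, hence an
  integer polynomial in their elementary symmetric functions.\<close>

lemma tribonacci_norm_int:
  fixes t1 t2 t3 :: complex
  assumes T: "\<And>z. z^3 - z^2 - z - 1 = (z - t1) * (z - t2) * (z - t3)"
    and e: "t1 + t2 + t3 = 1" "t1 * t2 + t1 * t3 + t2 * t3 = -1" "t1 * t2 * t3 = 1"
  shows "ipoly A t1 * ipoly A t2 * ipoly A t3 \<in> \<int>"
proof -
  obtain a b c :: int
    where "\<And>z. z^3 - z^2 - z - 1 = 0 \<Longrightarrow> ipoly A z = of_int a + of_int b * z + of_int c * z^2"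
    using ipoly_tribonacci_reduce by blast
  then have r: "ipoly A z = of_int a + of_int b * z + of_int c * z^2" if "z \<in> {t1, t2, t3}" for z
    using that T by auto
  have symm: "(x + y * t1 + z * t1^2) * (x + y * t2 + z * t2^2) * (x + y * t3 + z * t3^2) =
    x^3 + x^2 * y * (t1 + t2 + t3) + x^2 * z * ((t1 + t2 + t3)^2 - 2 * (t1 * t2 + t1 * t3 + t2 * t3))
    + x * y^2 * (t1 * t2 + t1 * t3 + t2 * t3)
    + x * y * z * ((t1 + t2 + t3) * (t1 * t2 + t1 * t3 + t2 * t3) - 3 * (t1 * t2 * t3))
    + x * z^2 * ((t1 * t2 + t1 * t3 + t2 * t3)^2 - 2 * (t1 + t2 + t3) * (t1 * t2 * t3))
    + y^3 * (t1 * t2 * t3) + y^2 * z * (t1 + t2 + t3) * (t1 * t2 * t3)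
    + y * z^2 * (t1 * t2 + t1 * t3 + t2 * t3) * (t1 * t2 * t3) + z^3 * (t1 * t2 * t3)^2" for x y z
    by algebra
  have "ipoly A t1 * ipoly A t2 * ipoly A t3 =
    of_int (a^3 + a^2*b + 3*a^2*c - a*b^2 - 4*a*b*c - a*c^2 + b^3 + b^2*c - b*c^2 + c^3)"
    by (subst (1 2 3) r; simp only: insert_iff simp_thms symm e) (simp add: algebra_simps)
  then show ?thesis by (metis Ints_of_int)
qed

text \<open>Modulo \<open>w^2 + w + 1\<close> this is the norm form \<open>a^2 - a b + b^2\<close>
  of the Eisenstein integers.\<close>

lemma eisenstein_norm_int:
  fixes w :: complex
  assumes w: "w^2 + w + 1 = 0"
  shows "ipoly A w * ipoly A (w^2) \<in> \<int>"
proof -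
  have "\<exists>a b :: int. \<forall>z. z^2 + z + 1 = 0 \<longrightarrow> ipoly A z = of_int a + of_int b * z"
  proof (induction A)
    case (pCons n A)
    then obtain a b :: int
      where ab: "\<And>z. z^2 + z + 1 = 0 \<Longrightarrow> ipoly A z = of_int a + of_int b * z"
      by blast
    have "ipoly (pCons n A) z = of_int (n - b) + of_int (a - b) * z"
      if "z^2 + z + 1 = 0" for z
      using that by (simp add: map_poly_pCons ab[OF that]) algebra
    then show ?case by blast
  qed (auto intro!: exI[of _ 0])
  then obtain a b :: int
    where ab: "\<And>z. z^2 + z + 1 = 0 \<Longrightarrow> ipoly A z = of_int a + of_int b * z"
    by blast
  have "(w^2)^2 + w^2 + 1 = 0" using w by algebra
  then have "ipoly A w * ipoly A (w^2) = of_int (a^2 - a * b + b^2)"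
    using w by (simp add: ab) algebra
  then show ?thesis by (metis Ints_of_int)
qed

section \<open>Products over roots, and factors with all roots on the circle\<close>

lemma poly_split_over_roots:
  fixes p :: "complex poly"
  assumes "p \<noteq> 0"
  obtains M where "size M = degree p" "\<And>z. z \<in># M \<longleftrightarrow> poly p z = 0"
    "\<And>t. norm (poly p t) = norm (lead_coeff p) * (\<Prod>x\<in>#M. norm (t - x))"
proof -
  obtain M where M: "size M = degree p" "p = smult (lead_coeff p) (\<Prod>x\<in>#M. [:-x, 1:])"
    using alg_closed_imp_factorization[OF assms] by blast
  have ev: "poly (\<Prod>x\<in>#M. [:-x, 1:]) t = (\<Prod>x\<in>#M. t - x)" for t
    by (induction M) (auto simp: algebra_simps)
  have p: "poly p t = lead_coeff p * (\<Prod>x\<in>#M. t - x)" for t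
    by (subst M(2)) (simp add: ev)
  have nm: "norm (\<Prod>x\<in>#M. t - x) = (\<Prod>x\<in>#M. norm (t - x))" for t :: complex
    by (induction M) (auto simp: norm_mult)
  show ?thesis
  proof (rule that[OF M(1)])
    show "z \<in># M \<longleftrightarrow> poly p z = 0" for z
      using assms by (auto simp: p prod_mset_zero_iff)
    show "norm (poly p t) = norm (lead_coeff p) * (\<Prod>x\<in>#M. norm (t - x))" for t
      by (simp only: p norm_mult nm)
  qed
qed

lemma prod_mset_ge_one_eq_oneD:
  fixes f :: "'a \<Rightarrow> real"
  assumes "\<And>x. x \<in># M \<Longrightarrow> 1 \<le> f x" "(\<Prod>x\<in>#M. f x) = 1" "y \<in># M"
  shows "f y = 1"
proof -
  obtain N where N: "M = add_mset y N" using assms(3) by (metis insert_DiffM)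
  have "1 \<le> (\<Prod>x\<in>#N. f x)"
    using assms(1) unfolding N
  proof (induction N)
    case (add x N)
    have "1 \<le> f x" "1 \<le> (\<Prod>x\<in>#N. f x)" using add by auto
    then have "1 * 1 \<le> f x * (\<Prod>x\<in>#N. f x)" by (intro mult_mono) auto
    then show ?case by simp
  qed simp
  then have "f y * 1 \<le> f y * (\<Prod>x\<in>#N. f x)"
    using assms(1)[OF assms(3)] by (intro mult_left_mono) auto
  moreover have "f y * (\<Prod>x\<in>#N. f x) = 1"
    using assms(2) by (simp add: N)
  ultimately show ?thesis
    using assms(1)[OF assms(3)] by linarith
qed

lemma prod_mset_strict_mono:
  fixes f g :: "'a \<Rightarrow> real"
  assumes "\<And>x. x \<in># M \<Longrightarrow> 0 \<le> f x" "\<And>x. x \<in># M \<Longrightarrow> f x < g x" "M \<noteq> {#}"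
  shows "(\<Prod>x\<in>#M. f x) < (\<Prod>x\<in>#M. g x)"
proof -
  obtain y N where M: "M = add_mset y N" using assms(3) by (metis multiset_cases)
  \<comment> \<open>The strictness will come from the one factor \<open>y\<close>. As the product of
    \<open>f\<close> may be 0, positivity of the product of \<open>g\<close> is carried through the
    induction.\<close>
  have N: "0 \<le> (\<Prod>x\<in>#N. f x) \<and> (\<Prod>x\<in>#N. f x) \<le> (\<Prod>x\<in>#N. g x) \<and> 0 < (\<Prod>x\<in>#N. g x)"
    using assms(1,2) unfolding M
  proof (induction N)
    case (add x N)
    have "0 \<le> f x" "f x < g x" using add.prems by auto
    moreover have "0 \<le> (\<Prod>x\<in>#N. f x) \<and> (\<Prod>x\<in>#N. f x) \<le> (\<Prod>x\<in>#N. g x) \<and> 0 < (\<Prod>x\<in>#N. g x)"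
      using add by auto
    ultimately show ?case by (auto intro!: mult_mono mult_pos_pos)
  qed auto
  have "0 \<le> f y" "f y < g y" using assms(1,2) M by auto
  with N have "f y * (\<Prod>x\<in>#N. f x) < g y * (\<Prod>x\<in>#N. g x)"
    by (meson mult_left_mono mult_strict_right_mono order_le_less_trans)
  then show ?thesis by (simp add: M)
qed

text \<open>The resultants of \<open>A\<close> with \<open>x^3 - 1\<close> and with \<open>T\<close>
  are compared root by root. Both are integers and the second is a unit, so the strict inequality
  makes the first vanish.\<close>

lemma P_poly_factor_root_of_unity:
  assumes P: "P_poly k = A * B" and k: "k \<ge> 1" and deg: "degree A > 0"
    and disc: "\<And>z. norm z < 1 \<Longrightarrow> ipoly A z \<noteq> 0"
    and w: "w^2 + w + 1 = 0"
  shows "ipoly A w * ipoly A (w^2) = 0"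
proof (rule ccontr)
  assume nz: "ipoly A w * ipoly A (w^2) \<noteq> 0"
  let ?A = "map_poly of_int A :: complex poly"
  have "lead_coeff A * lead_coeff B = 1"
    using P_poly_lead_coeff[of k] by (simp add: P lead_coeff_mult)
  then have "\<bar>lead_coeff A\<bar> = 1" by (metis abs_zmult_eq_1 abs_one)
  then have lc: "norm (lead_coeff ?A) = 1"
    by (simp add: degree_map_poly_of_int coeff_map_poly flip: of_int_abs)
  have "poly A 0 * poly B 0 = 1"
    using P_poly_0[of k] by (simp add: P)
  then have "\<bar>poly A 0\<bar> = 1" by (metis abs_zmult_eq_1 abs_one)
  then have A0: "norm (ipoly A 0) = 1"
    using ipoly_of_int[of A 0] by (simp flip: of_int_abs)
  have "?A \<noteq> 0" using lc by auto
  then obtain M where M: "size M = degree ?A" "\<And>z. z \<in># M \<longleftrightarrow> ipoly A z = 0"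
    "\<And>t. norm (ipoly A t) = norm (lead_coeff ?A) * (\<Prod>x\<in>#M. norm (t - x))"
    by (rule poly_split_over_roots) blast
  have AM: "norm (ipoly A t) = (\<Prod>x\<in>#M. norm (t - x))" for t
    using M(3)[of t] lc by simp
  have circle: "norm x = 1" if "x \<in># M" for x
  proof (rule prod_mset_ge_one_eq_oneD[OF _ _ that])
    show "1 \<le> norm y" if "y \<in># M" for y
      using that disc[of y] M(2) by force
    show "(\<Prod>x\<in>#M. norm x) = 1" using AM[of 0] A0 by simp
  qed
  obtain t1 t2 t3 :: complex where
    t: "\<And>z. z^3 - z^2 - z - 1 = (z - t1) * (z - t2) * (z - t3)"
    "t1 + t2 + t3 = 1" "t1 * t2 + t1 * t3 + t2 * t3 = -1" "t1 * t2 * t3 = 1"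
    by (rule tribonacci_factorization) blast
  have w3: "1 - z^3 = (1 - z) * (w - z) * (w^2 - z)" for z
    using w by algebra
  have less: "norm (1 - x^3) < norm (x^3 - x^2 - x - 1)" if "x \<in># M" for x
  proof -
    \<comment> \<open>In the circle identity, strictness could fail only at \<open>x = -1\<close>,
      where \<open>P\<close> is \<open>1 + 2 k\<close>.\<close>
    have "poly (P_poly k) (-1) \<noteq> 0" by (simp add: P_poly_minus_1)
    then have "ipoly (P_poly k) (of_int (-1)) \<noteq> 0" by (simp only: ipoly_of_int of_int_eq_0_iff) simp
    then have "x \<noteq> -1" using that M(2) by (auto simp: P ipoly_mult)
    then have "(norm (1 + x))^2 > 0" by (simp add: add_eq_0_iff)
    then have "(norm (1 - x^3))^2 < (norm (x^3 - x^2 - x - 1))^2"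
      using tribonacci_unit_circle_identity[OF circle[OF that]] by linarith
    then show ?thesis by (rule power2_less_imp_less) simp
  qed
  \<comment> \<open>Symmetry of the resultant: a product of cubic values over the roots of
    \<open>A\<close> becomes a product of values of \<open>A\<close>.\<close>
  have prod3: "(\<Prod>x\<in>#M. norm ((a - x) * (b - x) * (c - x))) = norm (ipoly A a * ipoly A b * ipoly A c)" for a b c
    unfolding norm_mult AM by (simp add: prod_mset.distrib)
  have "(\<Prod>x\<in>#M. norm (1 - x^3)) < (\<Prod>x\<in>#M. norm (x^3 - x^2 - x - 1))"
    using less M(1) deg by (intro prod_mset_strict_mono) (auto simp: degree_map_poly_of_int)
  also have "(\<Prod>x\<in>#M. norm (x^3 - x^2 - x - 1)) = (\<Prod>x\<in>#M. norm ((t1 - x) * (t2 - x) * (t3 - x)))"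
    by (simp only: t(1) norm_mult norm_minus_commute)
  also have "(\<Prod>x\<in>#M. norm (1 - x^3)) = (\<Prod>x\<in>#M. norm ((1 - x) * (w - x) * (w^2 - x)))"
    by (simp only: w3)
  finally have lt: "norm (ipoly A 1 * (ipoly A w * ipoly A (w^2))) < norm (ipoly A t1 * ipoly A t2 * ipoly A t3)"
    unfolding prod3 by (simp only: mult.assoc)
  obtain n where n: "ipoly A t1 * ipoly A t2 * ipoly A t3 = of_int n"
    using tribonacci_norm_int[OF t, of A] by (auto elim: Ints_cases)
  obtain n' where n': "ipoly B t1 * ipoly B t2 * ipoly B t3 = of_int n'"
    using tribonacci_norm_int[OF t, of B] by (auto elim: Ints_cases)
  have "ipoly A z * ipoly B z = 1" if "z \<in> {t1, t2, t3}" for z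
    using ipoly_P_tribonacci_root[of z k] that by (auto simp: P ipoly_mult t(1))
  then have "(ipoly A t1 * ipoly B t1) * (ipoly A t2 * ipoly B t2) * (ipoly A t3 * ipoly B t3) = 1"
    by simp
  then have "of_int n * of_int n' = (1 :: complex)"
    by (simp only: n[symmetric] n'[symmetric] mult_ac)
  then have "n * n' = 1" by (metis of_int_mult of_int_eq_1_iff)
  then have "\<bar>n\<bar> = 1" by (metis abs_zmult_eq_1 abs_one)
  then have n1: "norm (ipoly A t1 * ipoly A t2 * ipoly A t3) = 1"
    unfolding n by (simp flip: of_int_abs)
  obtain l where l: "ipoly A w * ipoly A (w^2) = of_int l"
    using eisenstein_norm_int[OF w, of A] by (auto elim: Ints_cases)
  \<comment> \<open>The value \<open>1 - 2 k\<close> is odd.\<close>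
  have "poly (P_poly k) 1 \<noteq> 0" by (simp add: P_poly_1) presburger
  then have "poly A 1 \<noteq> 0" by (auto simp: P)
  moreover have "l \<noteq> 0" using nz l by auto
  ultimately have "poly A 1 * l \<noteq> 0" by simp
  then have "1 \<le> \<bar>poly A 1 * l\<bar>" by linarith
  then have "1 \<le> norm (of_int (poly A 1 * l) :: complex)"
    unfolding norm_of_int by (simp only: of_int_1_le_iff flip: of_int_abs)
  also have "of_int (poly A 1 * l) = ipoly A 1 * (ipoly A w * ipoly A (w^2))"
    using ipoly_of_int[of A 1] l by simp
  finally show False using lt n1 by simp
qed

section \<open>The factor \<open>q^2 + q + 1\<close> and its multiplicity\<close>

text \<open>Three consecutive increments together contain \<open>1 + q^4 + q^8\<close>, which
  vanishes at primitive cube roots of unity.\<close>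

lemma dvd_P_poly: "[:1, 1, 1:] dvd P_poly (3 * j + 2)"
proof (induction j)
  case 0
  have "P_poly 2 = [:1, 1, 1:] * [:1, -2, 0, 1, 0, -2, 1:]"
    by (simp add: P_poly_def eval_nat_numeral monom_Suc monom_0 one_pCons)
  then show ?case by (metis add_0 dvd_triv_left mult_0_right)
next
  case (Suc j)
  define n where "n = 3 * j + 2"
  define f :: "int poly" where "f = [:0, -1, -1, -1, 1:]"
  have m: "monom 1 (4 * Suc n) = monom 1 (4 * n) * (monom 1 4 :: int poly)"
    "monom 1 (4 * Suc (Suc n)) = monom 1 (4 * n) * (monom 1 8 :: int poly)"
    by (simp_all add: mult_monom add.commute)
  have "1 + monom 1 4 + monom 1 8 = [:1, 1, 1:] * ([:1, -1, 1:] * [:1, 0, -1, 0, 1 :: int:])"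
    by (simp add: eval_nat_numeral monom_Suc monom_0 one_pCons)
  then have "[:1, 1, 1:] dvd monom 1 (4 * n) * f * (1 + monom 1 4 + monom 1 8)"
    by (metis dvd_triv_left dvd_mult)
  moreover have "P_poly (3 * Suc j + 2) = P_poly n + monom 1 (4 * n) * f * (1 + monom 1 4 + monom 1 8)"
  proof -
    have "3 * Suc j + 2 = Suc (Suc (Suc n))" by (simp add: n_def)
    then show ?thesis
      by (simp only: P_poly_Suc m f_def[symmetric]) (simp only: algebra_simps)
  qed
  ultimately show ?case using Suc n_def by (metis dvd_add)
qed

lemma R_poly_factorization:
  assumes "k mod 3 = 2"
  shows "P_poly k = R_poly k * [:1, 1, 1:]"
proof -
  have "k = 3 * (k div 3) + 2" using assms by presburger
  then have "[:1, 1, 1:] dvd P_poly k" by (metis dvd_P_poly)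
  then show ?thesis using assms unfolding R_poly_def by (simp only: if_P dvd_div_mult_self refl)
qed

text \<open>At \<open>w\<close> both \<open>T\<close> and \<open>T*\<close> equal 1, so a zero of
  \<open>P\<close> forces \<open>w^(4k+1) = 1\<close>, that is, \<open>k mod 3 = 2\<close>. In that
  case the claim is that \<open>w\<close> is only a simple root of \<open>P\<close>.\<close>

lemma R_poly_at_cube_root_of_unity:
  assumes w: "w^2 + w + 1 = 0"
  shows "ipoly (R_poly k) w \<noteq> 0"
proof
  assume R: "ipoly (R_poly k) w = 0"
  have w3: "w^3 = 1" using w by algebra
  have w1: "w \<noteq> 1" "w \<noteq> 0" using w by auto
  have pow: "w ^ n = w ^ (n mod 3)" for n
    by (metis div_mult_mod_eq mult_1 mult.commute power_add power_mult power_one w3)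
  show False
  proof (cases "k mod 3 = 2")
    case False
    then have "ipoly (P_poly k) w = 0" using R by (simp add: R_poly_def)
    then have "w^(4*k+1) * (w^3 - w^2 - w - 1) - (1 - w - w^2 - w^3) = 0"
      using ipoly_P_closed_form[of w k] by simp
    moreover have "w^3 - w^2 - w - 1 = 1" "1 - w - w^2 - w^3 = 1" using w by algebra+
    ultimately have "w^(4*k+1) = 1" by simp
    moreover have "(4*k+1) mod 3 = 1 \<or> (4*k+1) mod 3 = 2" using False by presburger
    ultimately have "w = 1 \<or> w^2 = 1" using pow[of "4*k+1"] by auto
    with w1 w3 show False by (auto simp: power2_eq_square power3_eq_cube)
  next
    case True
    \<comment> \<open>If \<open>R\<close> vanished at \<open>w\<close>, this product would have a
      double zero there; differentiating the closed form instead gives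
      \<open>(4k + 7) * w^2\<close>.\<close>
    define G where "G = (\<lambda>z. (z^4 - 1) * (ipoly (R_poly k) z * (z^2 + z + 1)))"
    have G: "G z = z^(4*k+1) * (z^3 - z^2 - z - 1) - (1 - z - z^2 - z^3)" for z
    proof -
      have "ipoly (P_poly k) z = ipoly (R_poly k) z * (z^2 + z + 1)"
        unfolding R_poly_factorization[OF True] ipoly_mult
        by (simp add: map_poly_pCons algebra_simps power2_eq_square)
      then show ?thesis using ipoly_P_closed_form[of z k] by (simp only: G_def)
    qed
    have "(G has_field_derivative 0) (at w)"
      unfolding G_def by (rule derivative_eq_intros poly_DERIV refl)+ (simp add: R w)
    moreover have "(G has_field_derivative
        of_nat (4*k+1) * w^(4*k) * (w^3 - w^2 - w - 1) + w^(4*k+1) * (3*w^2 - 2*w - 1) + 1 + 2*w + 3*w^2) (at w)"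
      unfolding G by (rule derivative_eq_intros refl)+ (simp add: algebra_simps)
    ultimately have "of_nat (4*k+1) * w^(4*k) * (w^3 - w^2 - w - 1) + w^(4*k+1) * (3*w^2 - 2*w - 1) + 1 + 2*w + 3*w^2 = 0"
      using DERIV_unique by blast
    moreover have "w^(4*k) = w^2" "w^(4*k+1) = 1"
    proof -
      have "(4*k) mod 3 = 2" "(4*k+1) mod 3 = 0" using True by presburger+
      then show "w^(4*k) = w^2" "w^(4*k+1) = 1" using pow[of "4*k"] pow[of "4*k+1"] by simp_all
    qed
    ultimately have "of_nat (4*k+1) * w^2 * (w^3 - w^2 - w - 1) + (3*w^2 - 2*w - 1) + 1 + 2*w + 3*w^2 = 0"
      by simp
    moreover have "w^3 - w^2 - w - 1 = 1" using w by algebra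
    ultimately have "of_nat (4*k+1) * w^2 * 1 + (3*w^2 - 2*w - 1) + 1 + 2*w + 3*w^2 = 0"
      by (simp only:)
    then have "of_nat (4*k+7) * w^2 = 0" by (simp add: algebra_simps)
    then show False using w1 by (metis mult_eq_0_iff of_nat_eq_0_iff add_is_0 power_not_zero zero_neq_numeral)
  qed
qed

text \<open>This treats both cases of \<open>R_poly\<close> uniformly; since \<open>P\<close> has
  degree \<open>4 k\<close>, the degree bound keeps \<open>R_poly\<close> non-constant for
  \<open>k \<ge> 1\<close>.\<close>

lemma R_poly_dvd: obtains C where "P_poly k = R_poly k * C" "degree C \<le> 2"
proof (cases "k mod 3 = 2")
  case True
  show ?thesis by (rule that[OF R_poly_factorization[OF True]]) simp
next
  case False
  show ?thesis by (rule that[of 1]) (use False in \<open>simp_all add: R_poly_def\<close>)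
qed

section \<open>Irreducibility of \<open>R\<close>\<close>

lemma R_poly_irreducible:
  assumes k: "k \<ge> 1"
  shows "irreducible (R_poly k)" "degree (R_poly k) > 0"
proof -
  obtain C where C: "P_poly k = R_poly k * C" "degree C \<le> 2" by (rule R_poly_dvd)
  have "P_poly k \<noteq> 0" using P_poly_lead_coeff[of k] by auto
  then have "degree (R_poly k) + degree C = 4 * k"
    using P_poly_degree[of k] C(1) by (metis degree_mult_eq mult_eq_0_iff)
  with C(2) k show deg: "degree (R_poly k) > 0" by linarith
  have lc: "lead_coeff (R_poly k) dvd 1"
    using P_poly_lead_coeff[of k] C(1) by (metis dvd_triv_left lead_coeff_mult)
  define w where "w = cis (2 * pi / 3)"
  have w: "w^2 + w + 1 = 0"
  proof -
    have "w^3 = 1" by (simp add: w_def Complex.DeMoivre)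
    moreover have "w \<noteq> 1"
      by (simp add: w_def complex_eq_iff cos_120)
    moreover have "(w - 1) * (w^2 + w + 1) = w^3 - 1" by algebra
    ultimately show ?thesis by simp
  qed
  have w2: "(w^2)^2 + w^2 + 1 = 0" using w by algebra
  have nonconst: False if AB: "R_poly k = A * B" and pos: "degree A > 0"
    and disc: "\<And>z. norm z < 1 \<Longrightarrow> ipoly A z \<noteq> 0" for A B
  proof -
    \<comment> \<open>Absorbing \<open>C\<close> into the cofactor makes the results on
      factorizations of \<open>P\<close> apply to factors of \<open>R\<close>.\<close>
    have "P_poly k = A * (B * C)" using C(1) AB by (simp add: mult.assoc)
    from P_poly_factor_root_of_unity[OF this k pos disc w]
    have "ipoly A w * ipoly A (w^2) = 0" by blast
    then show False
      using R_poly_at_cube_root_of_unity[OF w, of k] R_poly_at_cube_root_of_unity[OF w2, of k]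
      by (auto simp: AB ipoly_mult)
  qed
  \<comment> \<open>Over the integers constant factors need care: they divide the leading
    coefficient, which is a unit.\<close>
  have const: "A dvd 1" if AB: "R_poly k = A * B" and "degree A = 0" for A B
  proof -
    obtain c where c: "A = [:c:]" using \<open>degree A = 0\<close> by (rule degree_eq_zeroE)
    have "c dvd lead_coeff (R_poly k)" by (simp add: AB c lead_coeff_mult)
    then show ?thesis using lc by (metis c dvd_trans is_unit_const_poly_iff)
  qed
  show "irreducible (R_poly k)"
  proof (rule irreducibleI)
    show "R_poly k \<noteq> 0" using deg by auto
    show "\<not> R_poly k dvd 1" using deg by (auto simp: is_unit_poly_iff)
  next
    fix A B assume AB: "R_poly k = A * B"
    have BA: "R_poly k = B * A" using AB by (simp add: mult.commute)
    show "A dvd 1 \<or> B dvd 1"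
    proof (rule ccontr)
      assume "\<not> (A dvd 1 \<or> B dvd 1)"
      then have "degree A > 0" "degree B > 0" using const[OF AB] const[OF BA] by auto
      then obtain z w where "norm z < 1" "ipoly A z = 0" "norm w < 1" "ipoly B w = 0"
        using nonconst[OF AB] nonconst[OF BA] by blast
      then show False
        using P_poly_factors_disc_roots[of k A "B * C" z w] C(1) AB
        by (simp add: mult.assoc ipoly_mult)
    qed
  qed
qed

theorem mainTheorem3:
  fixes k :: nat
  assumes "k \<ge> 1"
  shows "(k mod 3 = 2 \<longrightarrow> P_poly k = R_poly k * [:1, 1, 1:])
         \<and> irreducible (map_poly (of_int :: int \<Rightarrow> rat) (R_poly k))"
  using R_poly_factorization R_poly_irreducible[OF assms] irreducible_map_poly_rat_of_int by blast

end
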